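(* Let $\mathcal{H} := \operatorname{conv}\{(x, xx^T, y, y_1y_2) : x\in\mathbb{R}^2,\ y\in\{0,1\}^2,\ 0\le x\le y\}$. Then $\mathcal{H}$ equals the projection onto $(x,X,y,Y_{12})$ of the set of all $(x,X,y,Y_{12},\alpha,\beta)$ (with $x,y,\alpha,\beta\in\mathbb{R}^2$, $X$ a real symmetric $2\times2$ matrix, $Y_{12}\in\mathbb{R}$) satisfying the convex constraints (a) $x\le y$; (b) $\begin{pmatrix} Y_{12} & (x-\alpha)^T\\ x-\alpha & X-\operatorname{Diag}(\beta)\end{pmatrix}\in \mathrm{PSD}\cap\mathrm{RLT}_x$; (c) $(\alpha_j,\beta_j,y_j-Y_{12})\in\mathrm{PER}$ for $j=1,2$; (d) $(y,Y_{12})\in\mathrm{RLT}_y$.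
   Context: Vector inequalities are componentwise; $\operatorname{diag}(X)$ is the vector of diagonal entries of $X$, and $\operatorname{Diag}(\beta)$ is the diagonal matrix with diagonal $\beta$. A point of $\mathcal{H}$ is written $(x,X,y,Y_{12})$, where $X$ is a symmetric $2\times2$ matrix and $Y_{12}$ is a scalar. $\mathrm{PSD}$ denotes the cone of (symmetric) positive semidefinite matrices. The perspective cone is $$\mathrm{PER}:=\{(a,b,c)\in\mathbb{R}^3 : a^2\le bc,\ 0\le b\le a\le c\}.$$ $\mathrm{RLT}_x$ is the set of symmetric $3\times 3$ matrices $\begin{pmatrix}\lambda & z^T\\ z& Z\end{pmatrix}$ (with $\lambda\in\mathbb{R}$, $z\in\mathbb{R}^2$, $Z$ symmetric $2\times2$) such that $\lambda\ge0$, $0\le\operatorname{diag}(Z)\le z$, and $\max\{0,z_1+z_2-\lambda\}\le Z_{12}\le\min\{z_1,z_2\}$. $$\mathrm{RLT}_y:=\{(y,Y_{12})\in\mathbb{R}^2\times\mathbb{R} : \max\{0,y_1+y_2-1\}\le Y_{12}\le\min\{y_1,y_2\}\}.$$ *)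

theory Defs
  imports "HOL-Analysis.Analysis"
begin

definition outer :: "real ^ 'n \<Rightarrow> real ^ 'n ^ 'n"
  where "outer x = (\<chi> i j. x $ i * x $ j)"

definition diag :: "real ^ 'n ^ 'n \<Rightarrow> real ^ 'n"
  where "diag A = (\<chi> i. A $ i $ i)"

definition Diag :: "real ^ 'n \<Rightarrow> real ^ 'n ^ 'n"
  where "Diag b = (\<chi> i j. if i = j then b $ i else 0)"

definition symmetric_matrix :: "real ^ 'n ^ 'n \<Rightarrow> bool"
  where "symmetric_matrix A \<longleftrightarrow> transpose A = A"

definition PSD :: "(real ^ 'n ^ 'n) set"
  where "PSD = {A. symmetric_matrix A \<and> (\<forall>v. 0 \<le> v \<bullet> (A *v v))}"

text \<open>The block matrix with rows \<open>(l, z\<^sup>T)\<close> and \<open>(z, Z)\<close>.\<close>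

definition bordered :: "real \<Rightarrow> real ^ 2 \<Rightarrow> real ^ 2 ^ 2 \<Rightarrow> real ^ 3 ^ 3"
  where "bordered l z Z = vector
    [vector [l,     z $ 1,     z $ 2],
     vector [z $ 1, Z $ 1 $ 1, Z $ 1 $ 2],
     vector [z $ 2, Z $ 2 $ 1, Z $ 2 $ 2]]"

definition PER :: "(real \<times> real \<times> real) set"
  where "PER = {(a, b, c). a\<^sup>2 \<le> b * c \<and> 0 \<le> b \<and> b \<le> a \<and> a \<le> c}"

text \<open>The order on \<^typ>\<open>real ^ 2\<close> is the componentwise one.\<close>

definition RLT_x :: "(real ^ 3 ^ 3) set"
  where "RLT_x = {bordered l z Z | l z Z.
    symmetric_matrix Z \<and> 0 \<le> l \<and> 0 \<le> diag Z \<and> diag Z \<le> z \<and>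
    max 0 (z $ 1 + z $ 2 - l) \<le> Z $ 1 $ 2 \<and> Z $ 1 $ 2 \<le> min (z $ 1) (z $ 2)}"

definition RLT_y :: "((real ^ 2) \<times> real) set"
  where "RLT_y = {(y, Y12).
    max 0 (y $ 1 + y $ 2 - 1) \<le> Y12 \<and> Y12 \<le> min (y $ 1) (y $ 2)}"

definition H :: "((real ^ 2) \<times> (real ^ 2 ^ 2) \<times> (real ^ 2) \<times> real) set"
  where "H = convex hull {(x, outer x, y, y $ 1 * y $ 2) | x y.
    (\<forall>j. y $ j \<in> {0, 1}) \<and> 0 \<le> x \<and> x \<le> y}"

definition extended_set ::
  "((real ^ 2) \<times> (real ^ 2 ^ 2) \<times> (real ^ 2) \<times> real \<times> (real ^ 2) \<times> (real ^ 2)) set"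
  where "extended_set = {(x, X, y, Y12, \<alpha>, \<beta>).
    symmetric_matrix X \<and>
    x \<le> y \<and>
    bordered Y12 (x - \<alpha>) (X - Diag \<beta>) \<in> PSD \<inter> RLT_x \<and>
    (\<forall>j. (\<alpha> $ j, \<beta> $ j, y $ j - Y12) \<in> PER) \<and>
    (y, Y12) \<in> RLT_y}"

end

theory Submission
  imports Defs
begin

text \<open>
  A point of the extended set splits according to the value of \<open>y\<close>: the weights of \<open>(1,1)\<close>, \<open>(1,0)\<close>,
  \<open>(0,1)\<close>, \<open>(0,0)\<close> are \<open>Y12\<close>, \<open>y1 - Y12\<close>, \<open>y2 - Y12\<close>, \<open>1 - y1 - y2 + Y12\<close>. Membership in \<open>PER\<close> makes
  \<open>(\<alpha>\<^sub>j, \<beta>\<^sub>j)\<close> the first two moments of a measure of mass \<open>y\<^sub>j - Y12\<close> on \<open>[0,1]\<close>, with atoms at \<open>0\<close>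
  and \<open>\<beta>\<^sub>j / \<alpha>\<^sub>j\<close>. What remains is the theorem of Anstreicher and Burer that the PSD and RLT constraints
  describe the convex hull of the points \<open>(x, x x\<^sup>T)\<close>, \<open>x \<in> [0,1]\<^sup>2\<close>.

  By Krein-Milman it suffices to treat an extreme point \<open>(x, X)\<close> of the relaxation. If a bound on
  \<open>X12\<close> is tight, the reflections \<open>x\<^sub>i \<mapsto> 1 - x\<^sub>i\<close> reduce to \<open>X12 = 0\<close>, and the Schur complement
  \<open>x1\<^sup>2 / X11 + x2\<^sup>2 / X22 \<le> 1\<close> leaves room for one atom on each axis and one at the origin. If
  \<open>diag X = x\<close>, the point is a mixture of the four vertices of the square. In all other cases a point with
  \<open>X \<noteq> x x\<^sup>T\<close> can be moved both ways along a segment in the relaxation.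
\<close>

section \<open>The PSD and RLT cone in scalar coordinates\<close>

text \<open>The arguments are the entries of a bordered matrix: corner \<open>l\<close>, border
  \<open>(a, b)\<close>, block with diagonal \<open>A\<close>, \<open>B\<close> and off-diagonal
  entry \<open>c\<close>. Keeping \<open>l\<close> free makes all conditions homogeneous.\<close>

definition rlt_psd :: "real \<Rightarrow> real \<Rightarrow> real \<Rightarrow> real \<Rightarrow> real \<Rightarrow> real \<Rightarrow> bool"
  where "rlt_psd l a b A B c \<longleftrightarrow>
    0 \<le> l \<and> A \<le> a \<and> B \<le> b \<and> 0 \<le> c \<and> a + b - l \<le> c \<and> c \<le> a \<and> c \<le> b \<and>
    (\<forall>u v w. 0 \<le> l * u\<^sup>2 + 2 * a * (u * v) + 2 * b * (u * w) + A * v\<^sup>2 + 2 * c * (v * w) + B * w\<^sup>2)"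

lemma rlt_psd_form:
  assumes "rlt_psd l a b A B c"
  shows "0 \<le> l * u\<^sup>2 + 2 * a * (u * v) + 2 * b * (u * w) + A * v\<^sup>2 + 2 * c * (v * w) + B * w\<^sup>2"
  using assms by (simp add: rlt_psd_def)

text \<open>The form at unit vectors gives \<open>0 \<le> A\<close> and \<open>0 \<le> B\<close>;
  adding \<open>a + b - l \<le> c\<close> and \<open>c \<le> b\<close> gives
  \<open>a \<le> l\<close>.\<close>

lemma rlt_psd_bounds:
  assumes "rlt_psd l a b A B c"
  shows "0 \<le> A" "0 \<le> B" "A \<le> a" "B \<le> b" "0 \<le> c" "a + b - l \<le> c" "c \<le> a" "c \<le> b" "a \<le> l" "b \<le> l" "0 \<le> l"
  using assms rlt_psd_form[OF assms, of 0 1 0] rlt_psd_form[OF assms, of 0 0 1]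
  by (auto simp: rlt_psd_def)

lemma rlt_psd_combination:
  assumes "rlt_psd l a b A B c" "rlt_psd l' a' b' A' B' c'" "0 \<le> s" "0 \<le> t"
  shows "rlt_psd (s * l + t * l') (s * a + t * a') (s * b + t * b')
    (s * A + t * A') (s * B + t * B') (s * c + t * c')"
  unfolding rlt_psd_def
proof (intro conjI allI)
  note b = rlt_psd_bounds[OF assms(1)] and b' = rlt_psd_bounds[OF assms(2)]
  note m = add_mono[OF mult_left_mono[OF _ assms(3)] mult_left_mono[OF _ assms(4)]]
  show "0 \<le> s * l + t * l'" using m[OF b(11) b'(11)] by simp
  show "s * A + t * A' \<le> s * a + t * a'" using m[OF b(3) b'(3)] by simp
  show "s * B + t * B' \<le> s * b + t * b'" using m[OF b(4) b'(4)] by simp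
  show "0 \<le> s * c + t * c'" using m[OF b(5) b'(5)] by simp
  show "s * a + t * a' + (s * b + t * b') - (s * l + t * l') \<le> s * c + t * c'"
    using m[OF b(6) b'(6)] by (simp add: algebra_simps)
  show "s * c + t * c' \<le> s * a + t * a'" using m[OF b(7) b'(7)] by simp
  show "s * c + t * c' \<le> s * b + t * b'" using m[OF b(8) b'(8)] by simp
  fix u v w
  show "0 \<le> (s * l + t * l') * u\<^sup>2 + 2 * (s * a + t * a') * (u * v) + 2 * (s * b + t * b') * (u * w)
    + (s * A + t * A') * v\<^sup>2 + 2 * (s * c + t * c') * (v * w) + (s * B + t * B') * w\<^sup>2"
    using m[OF rlt_psd_form[OF assms(1), of u v w] rlt_psd_form[OF assms(2), of u v w]]
    by (simp add: algebra_simps)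
qed

section \<open>The slice at corner 1 and the hull of moment vectors\<close>

definition rlt_psd_slice :: "(real \<times> real \<times> real \<times> real \<times> real) set"
  where "rlt_psd_slice = {(a, b, A, B, c). rlt_psd 1 a b A B c}"

text \<open>First and second moments of finitely supported probability measures on the unit
  square.\<close>

definition moment_hull :: "(real \<times> real \<times> real \<times> real \<times> real) set"
  where "moment_hull = convex hull {(a, b, a\<^sup>2, b\<^sup>2, a * b) | a b. 0 \<le> a \<and> a \<le> 1 \<and> 0 \<le> b \<and> b \<le> 1}"

lemma moment_hull_point:
  "0 \<le> a \<Longrightarrow> a \<le> 1 \<Longrightarrow> 0 \<le> b \<Longrightarrow> b \<le> 1 \<Longrightarrow> (a, b, a\<^sup>2, b\<^sup>2, a * b) \<in> moment_hull"
  unfolding moment_hull_def by (rule hull_inc) auto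

lemma convex_sum_list:
  fixes S :: "'a::real_vector set"
  assumes S: "convex S" and L: "\<forall>(w, p)\<in>set L. 0 \<le> w \<and> p \<in> S" and "(\<Sum>(w, p)\<leftarrow>L. w) = 1"
  shows "(\<Sum>(w, p)\<leftarrow>L. w *\<^sub>R p) \<in> S"
proof -
  have "(\<Sum>i<length L. fst (L ! i) *\<^sub>R snd (L ! i)) \<in> S"
    using assms by (intro convex_sum) (auto simp: sum_list_sum_nth case_prod_beta atLeast0LessThan)
  then show ?thesis by (simp add: sum_list_sum_nth case_prod_beta atLeast0LessThan)
qed

lemma compact_rlt_psd_slice: "compact rlt_psd_slice"
proof -
  have "rlt_psd_slice \<subseteq> {0..1} \<times> {0..1} \<times> {0..1} \<times> {0..1} \<times> {0..1}"
  proof (rule subsetI)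
    fix x assume x: "x \<in> rlt_psd_slice"
    obtain a b A B c where [simp]: "x = (a, b, A, B, c)" by (metis prod_cases5)
    from x have "rlt_psd 1 a b A B c" by (simp add: rlt_psd_slice_def)
    from rlt_psd_bounds[OF this]
    show "x \<in> {0..1} \<times> {0..1} \<times> {0..1} \<times> {0..1} \<times> {0..1}" by simp
  qed
  moreover have "compact ({0..1::real} \<times> {0..1::real} \<times> {0..1::real} \<times> {0..1::real} \<times> {0..1::real})"
    by (intro compact_Times compact_Icc)
  ultimately have "bounded rlt_psd_slice"
    using bounded_subset compact_imp_bounded by blast
  moreover have "closed rlt_psd_slice"
    unfolding rlt_psd_slice_def rlt_psd_def case_prod_beta
    by (intro closed_Collect_conj closed_Collect_all closed_Collect_le continuous_intros)
  ultimately show ?thesis by (simp add: compact_eq_bounded_closed)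
qed

lemma convex_rlt_psd_slice: "convex rlt_psd_slice"
proof (rule convexI)
  fix x y s t assume xy: "x \<in> rlt_psd_slice" "y \<in> rlt_psd_slice" and st: "0 \<le> s" "0 \<le> t" "s + t = (1::real)"
  obtain a b A B c a' b' A' B' c' where "x = (a, b, A, B, c)" "y = (a', b', A', B', c')"
    by (metis prod_cases5)
  then show "s *\<^sub>R x + t *\<^sub>R y \<in> rlt_psd_slice"
    using rlt_psd_combination[of 1 a b A B c 1 a' b' A' B' c' s t] xy st
    by (simp add: rlt_psd_slice_def)
qed

section \<open>Symmetries of the square\<close>

text \<open>These are the moments after replacing the first coordinate by one minus itself. The
  bound \<open>c = 0\<close> is exchanged with \<open>c = b\<close>, and \<open>c = a\<close> with
  \<open>c = a + b - 1\<close>.\<close>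

lemma reflect_rlt_psd:
  assumes "rlt_psd 1 a b A B c"
  shows "rlt_psd 1 (1 - a) b (1 - 2 * a + A) B (b - c)"
  unfolding rlt_psd_def
proof (intro conjI allI)
  fix u v w
  show "0 \<le> 1 * u\<^sup>2 + 2 * (1 - a) * (u * v) + 2 * b * (u * w) + (1 - 2 * a + A) * v\<^sup>2
    + 2 * (b - c) * (v * w) + B * w\<^sup>2"
    using rlt_psd_form[OF assms, of "u + v" "- v" w]
    by (simp add: algebra_simps power2_eq_square)
qed (use rlt_psd_bounds[OF assms] in auto)

lemma swap_rlt_psd:
  assumes "rlt_psd l a b A B c"
  shows "rlt_psd l b a B A c"
  unfolding rlt_psd_def
proof (intro conjI allI)
  fix u v w
  show "0 \<le> l * u\<^sup>2 + 2 * b * (u * v) + 2 * a * (u * w) + B * v\<^sup>2 + 2 * c * (v * w) + A * w\<^sup>2"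
    using rlt_psd_form[OF assms, of u w v] by (simp add: algebra_simps)
qed (use rlt_psd_bounds[OF assms] in auto)

text \<open>The reflection is affine and permutes the generators, so the preimage of the hull is
  convex and contains them.\<close>

lemma reflect_moment_hull:
  assumes "(a, b, A, B, c) \<in> moment_hull"
  shows "(1 - a, b, 1 - 2 * a + A, B, b - c) \<in> moment_hull"
proof -
  let ?T = "{(a, b, A, B, c). (1 - a, b, 1 - 2 * a + A, B, b - c) \<in> moment_hull}"
  have "convex ?T"
  proof (rule convexI)
    fix x y s t assume xy: "x \<in> ?T" "y \<in> ?T" and st: "0 \<le> s" "0 \<le> t" "s + t = (1::real)"
    obtain a b A B c a' b' A' B' c' where [simp]: "x = (a, b, A, B, c)" "y = (a', b', A', B', c')"
      by (metis prod_cases5)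
    have "s *\<^sub>R (1 - a, b, 1 - 2 * a + A, B, b - c) + t *\<^sub>R (1 - a', b', 1 - 2 * a' + A', B', b' - c')
      \<in> moment_hull"
      using xy st by (intro convexD) (auto simp: moment_hull_def)
    moreover have "s *\<^sub>R (1 - a, b, 1 - 2 * a + A, B, b - c) + t *\<^sub>R (1 - a', b', 1 - 2 * a' + A', B', b' - c')
      = (1 - (s * a + t * a'), s * b + t * b', 1 - 2 * (s * a + t * a') + (s * A + t * A'), s * B + t * B',
          s * b + t * b' - (s * c + t * c'))"
      using st(3) by (simp add: algebra_simps)
    ultimately show "s *\<^sub>R x + t *\<^sub>R y \<in> ?T" by simp
  qed
  moreover have "(1 - a, b, 1 - 2 * a + a\<^sup>2, b\<^sup>2, b - a * b) \<in> moment_hull"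
    if "0 \<le> a" "a \<le> 1" "0 \<le> b" "b \<le> 1" for a b
    using moment_hull_point[of "1 - a" b] that by (simp add: power2_eq_square algebra_simps)
  ultimately have "moment_hull \<subseteq> ?T"
    unfolding moment_hull_def by (intro hull_minimal) (auto simp: moment_hull_def[symmetric])
  then show ?thesis using assms by auto
qed

lemma swap_moment_hull:
  assumes "(a, b, A, B, c) \<in> moment_hull"
  shows "(b, a, B, A, c) \<in> moment_hull"
proof -
  let ?T = "{(a, b, A, B, c). (b, a, B, A, c) \<in> moment_hull}"
  have "convex ?T"
  proof (rule convexI)
    fix x y s t assume xy: "x \<in> ?T" "y \<in> ?T" and st: "0 \<le> s" "0 \<le> t" "s + t = (1::real)"
    obtain a b A B c a' b' A' B' c' where [simp]: "x = (a, b, A, B, c)" "y = (a', b', A', B', c')"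
      by (metis prod_cases5)
    have "s *\<^sub>R (b, a, B, A, c) + t *\<^sub>R (b', a', B', A', c') \<in> moment_hull"
      using xy st by (intro convexD) (auto simp: moment_hull_def)
    then show "s *\<^sub>R x + t *\<^sub>R y \<in> ?T" by simp
  qed
  moreover have "(b, a, b\<^sup>2, a\<^sup>2, a * b) \<in> moment_hull"
    if "0 \<le> a" "a \<le> 1" "0 \<le> b" "b \<le> 1" for a b
    using moment_hull_point[of b a] that by (simp add: mult.commute)
  ultimately have "moment_hull \<subseteq> ?T"
    unfolding moment_hull_def by (intro hull_minimal) (auto simp: moment_hull_def[symmetric])
  then show ?thesis using assms by auto
qed

lemma convex_moment_hull: "convex moment_hull"
  by (simp add: moment_hull_def)

section \<open>Points with tight constraints\<close>

lemma moment_hull_if_product_zero: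
  assumes "rlt_psd 1 a b A B 0"
  shows "(a, b, A, B, 0) \<in> moment_hull"
proof -
  note bd = rlt_psd_bounds[OF assms]
  \<comment> \<open>If \<open>a\<close> were nonzero, this vector would give the form the value
    \<open>1 - 2 = -1\<close>.\<close>
  have a0: "a = 0" if "A = 0"
    using rlt_psd_form[OF assms, of 1 "- 1 / a" 0] that by (cases "a = 0") auto
  have b0: "b = 0" if "B = 0"
    using rlt_psd_form[OF assms, of 1 0 "- 1 / b"] that by (cases "b = 0") auto
  \<comment> \<open>If \<open>A = 0\<close> then \<open>a = 0\<close>, so the quotients \<open>a\<^sup>2 / A\<close> and \<open>A / a\<close> have the intended value \<open>0\<close>.\<close>
  define p q where "p = a\<^sup>2 / A" and "q = b\<^sup>2 / B"
  \<comment> \<open>The test vector minimises the form over \<open>u = 1\<close>; the minimum is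
    \<open>1 - p - q\<close>, the weight left for the origin.\<close>
  have "p + q \<le> 1"
    using rlt_psd_form[OF assms, of 1 "- a / A" "- b / B"] unfolding p_def q_def
    by (cases "A = 0"; cases "B = 0") (auto simp: power2_eq_square)
  moreover have "0 \<le> p" "0 \<le> q"
    using bd by (auto simp: p_def q_def)
  moreover have "(A / a, 0, (A / a)\<^sup>2, 0, 0) \<in> moment_hull"
    using moment_hull_point[of "A / a" 0] bd by (cases "a = 0") (auto simp: divide_le_eq_1)
  moreover have "(0, B / b, 0, (B / b)\<^sup>2, 0) \<in> moment_hull"
    using moment_hull_point[of 0 "B / b"] bd by (cases "b = 0") (auto simp: divide_le_eq_1)
  moreover have "(0, 0, 0, 0, 0) \<in> moment_hull"
    using moment_hull_point[of 0 0] by simp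
  ultimately have "(\<Sum>(w, x)\<leftarrow>[(p, (A / a, 0, (A / a)\<^sup>2, 0, 0)), (q, (0, B / b, 0, (B / b)\<^sup>2, 0)),
      (1 - p - q, (0, 0, 0, 0, 0))]. w *\<^sub>R x) \<in> moment_hull"
    by (intro convex_sum_list convex_moment_hull) auto
  moreover have "p * (A / a) = a" "p * (A / a)\<^sup>2 = A"
    using a0 bd by (cases "a = 0"; auto simp: p_def power2_eq_square)+
  moreover have "q * (B / b) = b" "q * (B / b)\<^sup>2 = B"
    using b0 bd by (cases "b = 0"; auto simp: q_def power2_eq_square)+
  ultimately show ?thesis by simp
qed

lemma moment_hull_if_RLT_tight:
  assumes R: "rlt_psd 1 a b A B c" and tight: "c = 0 \<or> c = a + b - 1 \<or> c = a \<or> c = b"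
  shows "(a, b, A, B, c) \<in> moment_hull"
proof -
  have red_b: "(a, b, A, B, c) \<in> moment_hull" if R: "rlt_psd 1 a b A B c" and c: "c = b" for a b A B c
  proof -
    have "(1 - a, b, 1 - 2 * a + A, B, b - c) \<in> moment_hull"
      using moment_hull_if_product_zero reflect_rlt_psd[OF R] c by simp
    from reflect_moment_hull[OF this] show ?thesis by (simp add: algebra_simps)
  qed
  have red_a: "(a, b, A, B, c) \<in> moment_hull" if R: "rlt_psd 1 a b A B c" and c: "c = a" for a b A B c
    using swap_moment_hull[OF red_b[OF swap_rlt_psd[OF R] c]] .
  consider "c = 0" | "c = a" | "c = b" | "c = a + b - 1" using tight by auto
  then show ?thesis
  proof cases
    \<comment> \<open>Here \<open>b - c = 1 - a\<close>, so the reflected point attains the bound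
      treated in \<open>red_a\<close>.\<close>
    case 4
    then have "(1 - a, b, 1 - 2 * a + A, B, b - c) \<in> moment_hull"
      by (intro red_a[OF reflect_rlt_psd[OF R]]) simp
    from reflect_moment_hull[OF this] show ?thesis by (simp add: algebra_simps)
  qed (use R red_a red_b moment_hull_if_product_zero in blast)+
qed

text \<open>The four RLT bounds on \<open>c\<close> are exactly the nonnegativity of the four vertex
  weights.\<close>

lemma moment_hull_if_diagonal_tight:
  assumes "rlt_psd 1 a b a b c"
  shows "(a, b, a, b, c) \<in> moment_hull"
proof -
  have "(\<Sum>(w, x)\<leftarrow>[(c, (1, 1, 1, 1, 1)), (a - c, (1, 0, 1, 0, 0)), (b - c, (0, 1, 0, 1, 0)),
      (1 - a - b + c, (0, 0, 0, 0, 0))]. w *\<^sub>R x) \<in> moment_hull"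
    using rlt_psd_bounds[OF assms] moment_hull_point[of 0 0] moment_hull_point[of 0 1]
      moment_hull_point[of 1 0] moment_hull_point[of 1 1]
    by (intro convex_sum_list convex_moment_hull) auto
  then show ?thesis by simp
qed

section \<open>Perturbing points off the rank-one locus\<close>

text \<open>Completing the square. The linear form found supplies a direction in which a nonzero
  Schur complement tolerates a small rank-one change of either sign.\<close>

lemma psd_form_dominates_square:
  fixes m k n :: real
  assumes psd: "\<And>s t. 0 \<le> m * s\<^sup>2 + 2 * k * (s * t) + n * t\<^sup>2" and nz: "m \<noteq> 0 \<or> k \<noteq> 0 \<or> n \<noteq> 0"
  obtains p q e where "0 < e" "p \<noteq> 0 \<or> q \<noteq> 0"
    "\<And>s t. e * (p * s + q * t)\<^sup>2 \<le> m * s\<^sup>2 + 2 * k * (s * t) + n * t\<^sup>2"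
proof (cases "0 < m")
  case True
  have "k\<^sup>2 / m \<le> n"
    using psd[of "- k / m" 1] True by (simp add: power2_eq_square)
  have "1 / m * (m * s + k * t)\<^sup>2 \<le> m * s\<^sup>2 + 2 * k * (s * t) + n * t\<^sup>2" for s t
  proof -
    have "1 / m * (m * s + k * t)\<^sup>2 = m * s\<^sup>2 + 2 * k * (s * t) + k\<^sup>2 / m * t\<^sup>2"
      using True by (simp add: power2_eq_square field_simps)
    also have "\<dots> \<le> m * s\<^sup>2 + 2 * k * (s * t) + n * t\<^sup>2"
      using mult_right_mono[OF \<open>k\<^sup>2 / m \<le> n\<close>, of "t\<^sup>2"] by simp
    finally show ?thesis .
  qed
  then show ?thesis using that[of "1 / m" m k] True by simp
next
  case False
  then have m: "m = 0" using psd[of 1 0] by simp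
  \<comment> \<open>For \<open>m = 0\<close> and \<open>k \<noteq> 0\<close> the chosen vector gives
    the value \<open>-1\<close>.\<close>
  have k: "k = 0"
    using psd[of "- (n + 1) / (2 * k)" 1] m by (cases "k = 0") auto
  have "0 \<le> n" using psd[of 0 1] by simp
  then show ?thesis using that[of n 0 1] m k nz by auto
qed

text \<open>The perturbation is \<open>U D U\<^sup>T\<close> for \<open>U\<close> with columns \<open>(1, a, b)\<close> and \<open>(0, p, q)\<close> and
  \<open>D\<close> with rows \<open>(0, s)\<close> and \<open>(s, t)\<close>. It changes the Schur complement by \<open>(t - s\<^sup>2) v v\<^sup>T\<close>,
  \<open>v = (p, q)\<close>, and the ratio of \<open>s\<close> and \<open>t\<close> is chosen so that \<open>A - a\<close> is preserved.\<close>

lemma rlt_psd_slice_perturbation: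
  assumes R: "rlt_psd 1 a b A B c"
    and strict: "0 < c" "a + b - 1 < c" "c < a" "c < b" "B < b"
    and nz: "\<not> (A = a\<^sup>2 \<and> B = b\<^sup>2 \<and> c = a * b)"
  obtains d where "d \<noteq> 0" "(a, b, A, B, c) + d \<in> rlt_psd_slice" "(a, b, A, B, c) - d \<in> rlt_psd_slice"
proof -
  \<comment> \<open>Minimising the form over \<open>u\<close> leaves the Schur complement of the
    corner.\<close>
  have M: "0 \<le> (A - a\<^sup>2) * s\<^sup>2 + 2 * (c - a * b) * (s * t) + (B - b\<^sup>2) * t\<^sup>2" for s t
    using rlt_psd_form[OF R, of "- (a * s + b * t)" s t]
    by (simp add: power2_eq_square algebra_simps)
  have M_nz: "A - a\<^sup>2 \<noteq> 0 \<or> c - a * b \<noteq> 0 \<or> B - b\<^sup>2 \<noteq> 0" using nz by auto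
  obtain p q e where e: "0 < e" and pq: "p \<noteq> 0 \<or> q \<noteq> 0"
    and dom: "\<And>s t. e * (p * s + q * t)\<^sup>2 \<le> (A - a\<^sup>2) * s\<^sup>2 + 2 * (c - a * b) * (s * t) + (B - b\<^sup>2) * t\<^sup>2"
    by (rule psd_form_dominates_square[OF M M_nz]) (rule that)
  \<comment> \<open>For \<open>p \<noteq> 0\<close> these solve
    \<open>2 * s * a * p + t * p^2 = s * p\<close>, so \<open>A\<close> and \<open>a\<close> move
    equally. For \<open>p = 0\<close> both sides vanish, and \<open>t = 1\<close> keeps
    \<open>d\<close> nonzero through its entry \<open>q^2\<close>.\<close>
  define s t where "s = p" and "t = (if p = 0 then 1 else 1 - 2 * a)"
  define d where "d = (s * p, s * q, 2 * s * a * p + t * p\<^sup>2, 2 * s * b * q + t * q\<^sup>2,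
    s * (a * q + b * p) + t * p * q)"
  define g h where "g = s * (a * q + b * p) + t * p * q" and "h = 2 * s * b * q + t * q\<^sup>2"
  have dnz: "d \<noteq> 0" using pq by (auto simp: d_def s_def t_def zero_prod_def)
  have diag: "2 * s * a * p + t * p\<^sup>2 = s * p"
    by (auto simp: s_def t_def power2_eq_square algebra_simps)
  \<comment> \<open>The first condition on \<open>r\<close> protects the quadratic form, the next
    four the RLT bounds on \<open>c\<close>, the last \<open>B \<le> b\<close>.\<close>
  have step: "(a, b, A, B, c) + r *\<^sub>R d \<in> rlt_psd_slice"
    if r: "r\<^sup>2 * s\<^sup>2 - r * t < e" "- c < r * g" "a + b - 1 - c < r * (g - s * p - s * q)"
      "r * (g - s * p) < a - c" "r * (g - s * q) < b - c" "r * (h - s * q) < b - B" for r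
  proof -
    have "rlt_psd 1 (a + r * (s * p)) (b + r * (s * q)) (A + r * (2 * s * a * p + t * p\<^sup>2))
      (B + r * h) (c + r * g)"
      unfolding rlt_psd_def
    proof (intro conjI allI)
      show "A + r * (2 * s * a * p + t * p\<^sup>2) \<le> a + r * (s * p)"
        using rlt_psd_bounds(3)[OF R] unfolding diag by simp
      fix u v w
      have "0 \<le> (u + (a + r * (s * p)) * v + (b + r * (s * q)) * w)\<^sup>2" by simp
      moreover have "(r\<^sup>2 * s\<^sup>2 - r * t) * (p * v + q * w)\<^sup>2 \<le> e * (p * v + q * w)\<^sup>2"
        using r(1) by (intro mult_right_mono) auto
      moreover note dom[of v w]
      ultimately have "0 \<le> (u + (a + r * (s * p)) * v + (b + r * (s * q)) * w)\<^sup>2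
        + ((A - a\<^sup>2) * v\<^sup>2 + 2 * (c - a * b) * (v * w) + (B - b\<^sup>2) * w\<^sup>2
        - (r\<^sup>2 * s\<^sup>2 - r * t) * (p * v + q * w)\<^sup>2)"
        by linarith
      also have "\<dots> = 1 * u\<^sup>2 + 2 * (a + r * (s * p)) * (u * v) + 2 * (b + r * (s * q)) * (u * w)
        + (A + r * (2 * s * a * p + t * p\<^sup>2)) * v\<^sup>2 + 2 * (c + r * g) * (v * w) + (B + r * h) * w\<^sup>2"
        unfolding g_def h_def by algebra
      finally show "0 \<le> 1 * u\<^sup>2 + 2 * (a + r * (s * p)) * (u * v) + 2 * (b + r * (s * q)) * (u * w)
        + (A + r * (2 * s * a * p + t * p\<^sup>2)) * v\<^sup>2 + 2 * (c + r * g) * (v * w) + (B + r * h) * w\<^sup>2" .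
    qed (use r(2-) in \<open>simp_all add: right_diff_distrib\<close>)
    then show ?thesis by (simp add: rlt_psd_slice_def d_def g_def h_def)
  qed
  \<comment> \<open>Each left or right side depending on \<open>r\<close> tends to 0 while the slack
    is positive; the filter is two-sided, so both signs of \<open>r\<close> are covered.\<close>
  have "\<forall>\<^sub>F r in at 0. (a, b, A, B, c) + r *\<^sub>R d \<in> rlt_psd_slice"
  proof -
    have lim: "((\<lambda>r. r * k) \<longlongrightarrow> 0) (at (0::real))" "((\<lambda>r. r\<^sup>2 * s\<^sup>2 - r * k) \<longlongrightarrow> 0) (at (0::real))" for k
      by (auto intro!: tendsto_eq_intros)
    have "\<forall>\<^sub>F r in at 0. r\<^sup>2 * s\<^sup>2 - r * t < e" "\<forall>\<^sub>F r in at 0. - c < r * g"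
      "\<forall>\<^sub>F r in at 0. a + b - 1 - c < r * (g - s * p - s * q)"
      "\<forall>\<^sub>F r in at 0. r * (g - s * p) < a - c" "\<forall>\<^sub>F r in at 0. r * (g - s * q) < b - c"
      "\<forall>\<^sub>F r in at 0. r * (h - s * q) < b - B"
      using e strict by (intro order_tendstoD(1)[OF lim(1)] order_tendstoD(2)[OF lim(1)]
          order_tendstoD(2)[OF lim(2)]; simp)+
    then show ?thesis by eventually_elim (rule step)
  qed
  then obtain r where "0 < r"
    and "\<And>r'. r' \<noteq> 0 \<Longrightarrow> \<bar>r'\<bar> < r \<Longrightarrow> (a, b, A, B, c) + r' *\<^sub>R d \<in> rlt_psd_slice"
    unfolding eventually_at dist_real_def by auto
  from this(1) this(2)[of "r / 2"] this(2)[of "- r / 2"] show ?thesis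
    using that[of "(r / 2) *\<^sub>R d"] dnz by simp
qed

section \<open>Extreme points of the slice\<close>

lemma rlt_psd_slice_subset_moment_hull: "rlt_psd_slice \<subseteq> moment_hull"
proof -
  have no_perturbation: "d = 0" if "x extreme_point_of rlt_psd_slice"
    "x + d \<in> rlt_psd_slice" "x - d \<in> rlt_psd_slice" for x d
  proof (rule ccontr)
    assume "d \<noteq> 0"
    then have "x + d \<noteq> x - d" by (simp add: eq_neg_iff_add_eq_0 flip: scaleR_2)
    then have "midpoint (x + d) (x - d) \<in> open_segment (x + d) (x - d)" by simp
    then show False using that by (simp add: extreme_point_of_def midpoint_def flip: scaleR_2)
  qed
  have "(a, b, A, B, c) \<in> moment_hull" if ext: "(a, b, A, B, c) extreme_point_of rlt_psd_slice" for a b A B c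
  proof -
    have R: "rlt_psd 1 a b A B c"
      using ext by (simp add: extreme_point_of_def rlt_psd_slice_def)
    note bd = rlt_psd_bounds[OF R]
    consider "c = 0 \<or> c = a + b - 1 \<or> c = a \<or> c = b" | "A = a" "B = b"
      | "A = a\<^sup>2 \<and> B = b\<^sup>2 \<and> c = a * b"
      | "0 < c" "a + b - 1 < c" "c < a" "c < b" "A < a \<or> B < b" "\<not> (A = a\<^sup>2 \<and> B = b\<^sup>2 \<and> c = a * b)"
      using bd by (smt (verit))
    then show ?thesis
    proof cases
      case 1 then show ?thesis using moment_hull_if_RLT_tight R by blast
    next
      case 2 then show ?thesis using moment_hull_if_diagonal_tight R by simp
    next
      case 3 then show ?thesis using moment_hull_point[of a b] bd by simp
    next
      case 4
      from 4(5) show ?thesis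
      proof
        assume "B < b"
        then show ?thesis
          using rlt_psd_slice_perturbation[OF R 4(1-4) _ 4(6)] no_perturbation[OF ext] by metis
      next
        \<comment> \<open>The perturbation needs slack in the second diagonal entry, so the
          coordinates are swapped and the direction found is permuted back.\<close>
        assume "A < a"
        moreover have "\<not> (B = b\<^sup>2 \<and> A = a\<^sup>2 \<and> c = b * a)" using 4(6) by (auto simp: mult.commute)
        ultimately obtain d where d: "d \<noteq> 0" "(b, a, B, A, c) + d \<in> rlt_psd_slice"
          "(b, a, B, A, c) - d \<in> rlt_psd_slice"
          using rlt_psd_slice_perturbation[OF swap_rlt_psd[OF R]] 4 by (metis add.commute)
        obtain d1 d2 d3 d4 d5 where "d = (d1, d2, d3, d4, d5)" by (metis prod_cases5)
        with d no_perturbation[OF ext, of "(d2, d1, d4, d3, d5)"] show ?thesis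
          by (auto simp: rlt_psd_slice_def zero_prod_def dest: swap_rlt_psd)
      qed
    qed
  qed
  then have "convex hull {x. x extreme_point_of rlt_psd_slice} \<subseteq> moment_hull"
    by (intro hull_minimal convex_moment_hull) auto
  then show ?thesis
    using Krein_Milman_Minkowski[OF compact_rlt_psd_slice convex_rlt_psd_slice] by simp
qed

section \<open>From matrices to scalar coordinates\<close>

lemma bordered_in_PSD_iff:
  "bordered l z Z \<in> PSD \<longleftrightarrow> Z $ 1 $ 2 = Z $ 2 $ 1 \<and>
    (\<forall>u v w. 0 \<le> l * u\<^sup>2 + 2 * z $ 1 * (u * v) + 2 * z $ 2 * (u * w) + Z $ 1 $ 1 * v\<^sup>2
      + 2 * Z $ 1 $ 2 * (v * w) + Z $ 2 $ 2 * w\<^sup>2)"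
proof -
  have "symmetric_matrix (bordered l z Z) \<longleftrightarrow> Z $ 1 $ 2 = Z $ 2 $ 1"
    by (auto simp: symmetric_matrix_def bordered_def transpose_def vec_eq_iff forall_3)
  moreover have "v \<bullet> (bordered l z Z *v v) = l * (v $ 1)\<^sup>2 + 2 * z $ 1 * (v $ 1 * v $ 2)
      + 2 * z $ 2 * (v $ 1 * v $ 3) + Z $ 1 $ 1 * (v $ 2)\<^sup>2 + 2 * Z $ 1 $ 2 * (v $ 2 * v $ 3)
      + Z $ 2 $ 2 * (v $ 3)\<^sup>2" if "Z $ 1 $ 2 = Z $ 2 $ 1" for v
    using that by (simp add: bordered_def matrix_vector_mult_def inner_vec_def sum_3
        power2_eq_square algebra_simps)
  moreover have "(\<forall>v::real^3. P (v $ 1) (v $ 2) (v $ 3)) \<longleftrightarrow> (\<forall>a b c. P a b c)" for P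
    by (metis vector_3)
  note this[of "\<lambda>u v w. 0 \<le> l * u\<^sup>2 + 2 * z $ 1 * (u * v) + 2 * z $ 2 * (u * w)
      + Z $ 1 $ 1 * v\<^sup>2 + 2 * Z $ 1 $ 2 * (v * w) + Z $ 2 $ 2 * w\<^sup>2"]
  ultimately show ?thesis unfolding PSD_def mem_Collect_eq by metis
qed

lemma bordered_eq_iff: "bordered l z Z = bordered l' z' Z' \<longleftrightarrow> l = l' \<and> z = z' \<and> Z = Z'"
  by (auto simp: bordered_def vec_eq_iff forall_3 forall_2)

lemma bordered_in_PSD_RLT_x_iff:
  "bordered l z Z \<in> PSD \<inter> RLT_x \<longleftrightarrow>
    Z $ 1 $ 2 = Z $ 2 $ 1 \<and> rlt_psd l (z $ 1) (z $ 2) (Z $ 1 $ 1) (Z $ 2 $ 2) (Z $ 1 $ 2)"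
proof -
  have "bordered l z Z \<in> RLT_x \<longleftrightarrow> symmetric_matrix Z \<and> 0 \<le> l \<and> 0 \<le> diag Z \<and> diag Z \<le> z \<and>
    max 0 (z $ 1 + z $ 2 - l) \<le> Z $ 1 $ 2 \<and> Z $ 1 $ 2 \<le> min (z $ 1) (z $ 2)"
    unfolding RLT_x_def by (auto simp: bordered_eq_iff)
  moreover have "symmetric_matrix Z \<longleftrightarrow> Z $ 1 $ 2 = Z $ 2 $ 1"
    by (auto simp: symmetric_matrix_def transpose_def vec_eq_iff forall_2)
  moreover have "0 \<le> diag Z \<longleftrightarrow> 0 \<le> Z $ 1 $ 1 \<and> 0 \<le> Z $ 2 $ 2"
    "diag Z \<le> z \<longleftrightarrow> Z $ 1 $ 1 \<le> z $ 1 \<and> Z $ 2 $ 2 \<le> z $ 2"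
    by (simp_all add: less_eq_vec_def diag_def forall_2)
  ultimately show ?thesis
    using rlt_psd_bounds(1,2)[of l "z $ 1" "z $ 2" "Z $ 1 $ 1" "Z $ 2 $ 2" "Z $ 1 $ 2"]
    unfolding Int_iff bordered_in_PSD_iff rlt_psd_def max.bounded_iff min.bounded_iff by argo
qed

text \<open>\<open>Diag \<beta>\<close> shifts only the diagonal, so \<open>X $ 1 $ 2\<close> enters
  the block unchanged.\<close>

lemma extended_set_iff:
  "(x, X, y, Y12, \<alpha>, \<beta>) \<in> extended_set \<longleftrightarrow>
    X $ 1 $ 2 = X $ 2 $ 1 \<and> x $ 1 \<le> y $ 1 \<and> x $ 2 \<le> y $ 2 \<and>
    rlt_psd Y12 (x $ 1 - \<alpha> $ 1) (x $ 2 - \<alpha> $ 2) (X $ 1 $ 1 - \<beta> $ 1) (X $ 2 $ 2 - \<beta> $ 2) (X $ 1 $ 2) \<and>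
    (\<alpha> $ 1, \<beta> $ 1, y $ 1 - Y12) \<in> PER \<and> (\<alpha> $ 2, \<beta> $ 2, y $ 2 - Y12) \<in> PER \<and>
    0 \<le> Y12 \<and> y $ 1 + y $ 2 - 1 \<le> Y12 \<and> Y12 \<le> y $ 1 \<and> Y12 \<le> y $ 2"
  unfolding extended_set_def mem_Collect_eq prod.case bordered_in_PSD_RLT_x_iff
  by (auto simp: less_eq_vec_def forall_2 RLT_y_def Diag_def symmetric_matrix_def transpose_def vec_eq_iff)

section \<open>Convexity of the extended set and lifting of generators\<close>

text \<open>\<open>PER\<close> is a slice of a rotated second-order cone by linear inequalities. The
  cross term follows from \<open>4 * (b * c') * (b' * c) \<le> (b * c' + b' * c)^2\<close>.\<close>

lemma PER_combination:
  assumes "(a, b, c) \<in> PER" "(a', b', c') \<in> PER" and st: "0 \<le> s" "0 \<le> t"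
  shows "(s * a + t * a', s * b + t * b', s * c + t * c') \<in> PER"
proof -
  have h: "a\<^sup>2 \<le> b * c" "0 \<le> b" "b \<le> a" "a \<le> c" "a'\<^sup>2 \<le> b' * c'" "0 \<le> b'" "b' \<le> a'" "a' \<le> c'"
    using assms by (auto simp: PER_def)
  have "2 * (a * a') \<le> b * c' + b' * c"
  proof (rule power2_le_imp_le)
    have "a\<^sup>2 * a'\<^sup>2 \<le> (b * c) * (b' * c')" using h by (intro mult_mono) auto
    moreover have "0 \<le> (b * c' - b' * c)\<^sup>2" by simp
    ultimately show "(2 * (a * a'))\<^sup>2 \<le> (b * c' + b' * c)\<^sup>2"
      by (simp add: power2_eq_square algebra_simps)
  qed (use h in simp)
  then have "s * t * (2 * (a * a')) \<le> s * t * (b * c' + b' * c)"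
    using st by (intro mult_left_mono) auto
  moreover have "s\<^sup>2 * a\<^sup>2 \<le> s\<^sup>2 * (b * c)" "t\<^sup>2 * a'\<^sup>2 \<le> t\<^sup>2 * (b' * c')"
    using h by (auto intro: mult_left_mono)
  ultimately have "(s * a + t * a')\<^sup>2 \<le> (s * b + t * b') * (s * c + t * c')"
    by (simp add: power2_eq_square algebra_simps)
  then show ?thesis
    using h st by (auto simp: PER_def intro!: add_mono mult_left_mono)
qed

lemma convex_extended_set: "convex extended_set"
proof (rule convexI)
  fix p p' s t assume pp: "p \<in> extended_set" "p' \<in> extended_set"
    and st: "0 \<le> s" "0 \<le> t" "s + t = (1::real)"
  obtain x X y Y \<alpha> \<beta> where [simp]: "p = (x, X, y, Y, \<alpha>, \<beta>)" by (metis prod_cases6)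
  obtain x' X' y' Y' \<alpha>' \<beta>' where [simp]: "p' = (x', X', y', Y', \<alpha>', \<beta>')" by (metis prod_cases6)
  note E = pp[simplified, unfolded extended_set_iff]
  note m = add_mono[OF mult_left_mono[OF _ st(1)] mult_left_mono[OF _ st(2)]]
  have "rlt_psd (s * Y + t * Y') (s * (x $ 1 - \<alpha> $ 1) + t * (x' $ 1 - \<alpha>' $ 1))
    (s * (x $ 2 - \<alpha> $ 2) + t * (x' $ 2 - \<alpha>' $ 2)) (s * (X $ 1 $ 1 - \<beta> $ 1) + t * (X' $ 1 $ 1 - \<beta>' $ 1))
    (s * (X $ 2 $ 2 - \<beta> $ 2) + t * (X' $ 2 $ 2 - \<beta>' $ 2)) (s * X $ 1 $ 2 + t * X' $ 1 $ 2)"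
    using E st by (intro rlt_psd_combination) auto
  moreover have "(s * \<alpha> $ j + t * \<alpha>' $ j, s * \<beta> $ j + t * \<beta>' $ j, s * (y $ j - Y) + t * (y' $ j - Y')) \<in> PER"
    if "j = 1 \<or> j = 2" for j
    using that E st by (intro PER_combination) auto
  moreover have "s * (y $ 1 + y $ 2 - 1) + t * (y' $ 1 + y' $ 2 - 1) \<le> s * Y + t * Y'"
    using E by (intro m) auto
  moreover have "s * (y $ 1 + y $ 2 - 1) + t * (y' $ 1 + y' $ 2 - 1)
    = s * y $ 1 + t * y' $ 1 + (s * y $ 2 + t * y' $ 2) - 1"
    using st(3) by (simp add: algebra_simps)
  moreover have "s * x $ j + t * x' $ j \<le> s * y $ j + t * y' $ j" "s * Y + t * Y' \<le> s * y $ j + t * y' $ j"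
    if "j = 1 \<or> j = 2" for j
    using that E by (auto intro!: m)
  moreover have "0 \<le> s * Y + t * Y'" using E st by simp
  ultimately show "s *\<^sub>R p + t *\<^sub>R p' \<in> extended_set"
    using E by (simp add: extended_set_iff right_diff_distrib add_diff_add)
qed

lemma rlt_psd_rank_one:
  assumes "0 \<le> a" "a \<le> 1" "0 \<le> b" "b \<le> 1"
  shows "rlt_psd 1 a b (a\<^sup>2) (b\<^sup>2) (a * b)"
  unfolding rlt_psd_def
proof (intro conjI allI)
  \<comment> \<open>The lower RLT bound is this product expanded; the form below is the square of a
    linear form.\<close>
  have "0 \<le> (1 - a) * (1 - b)" using assms by simp
  then show "a + b - 1 \<le> a * b" by (simp add: algebra_simps)
  fix u v w
  have "0 \<le> (u + a * v + b * w)\<^sup>2" by simp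
  also have "\<dots> = 1 * u\<^sup>2 + 2 * a * (u * v) + 2 * b * (u * w) + a\<^sup>2 * v\<^sup>2 + 2 * (a * b) * (v * w) + b\<^sup>2 * w\<^sup>2"
    by algebra
  finally show "0 \<le> 1 * u\<^sup>2 + 2 * a * (u * v) + 2 * b * (u * w) + a\<^sup>2 * v\<^sup>2 + 2 * (a * b) * (v * w) + b\<^sup>2 * w\<^sup>2" .
qed (use assms in \<open>auto simp: power2_eq_square mult_left_le mult_left_le_one_le mult_le_one\<close>)

lemma rlt_psd_zero: "rlt_psd 0 0 0 0 0 0"
  by (simp add: rlt_psd_def)

lemma generator_lifts:
  assumes y: "\<forall>j. y $ j \<in> {0, 1}" and x: "0 \<le> x" "x \<le> y"
  obtains \<alpha> \<beta> where "(x, outer x, y, y $ 1 * y $ 2, \<alpha>, \<beta>) \<in> extended_set"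
proof (cases "y $ 1 = 1 \<and> y $ 2 = 1")
  case True
  then have "(x, outer x, y, y $ 1 * y $ 2, 0, 0) \<in> extended_set"
    using x rlt_psd_rank_one[of "x $ 1" "x $ 2"]
    by (simp add: extended_set_iff outer_def PER_def less_eq_vec_def forall_2 power2_eq_square mult.commute)
  then show ?thesis by (rule that)
next
  case False
  have le: "x $ j * x $ j \<le> x $ j" if "x $ j \<le> 1" for j
    using that x(1) by (simp add: less_eq_vec_def mult_left_le)
  \<comment> \<open>Some \<open>y $ j\<close> is 0, so \<open>x $ 1 * x $ 2 = 0\<close>: the
    bordered block vanishes and all moments go into \<open>\<alpha>\<close> and
    \<open>\<beta>\<close>.\<close>
  have "(x, outer x, y, y $ 1 * y $ 2, x, \<chi> j. (x $ j)\<^sup>2) \<in> extended_set"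
    using y x False le[of 1] le[of 2] rlt_psd_zero
    by (auto simp: extended_set_iff outer_def PER_def less_eq_vec_def forall_2 power2_eq_square)
  then show ?thesis by (rule that)
qed

section \<open>Decomposing a point of the extended set\<close>

definition scalar_point ::
  "real \<Rightarrow> real \<Rightarrow> real \<Rightarrow> real \<Rightarrow> real \<Rightarrow> real \<Rightarrow> real \<Rightarrow> real \<Rightarrow> (real ^ 2) \<times> (real ^ 2 ^ 2) \<times> (real ^ 2) \<times> real"
  where "scalar_point a b A B c y1 y2 Y =
    (vector [a, b], vector [vector [A, c], vector [c, B]], vector [y1, y2], Y)"

lemma scalar_point_add:
  "scalar_point a b A B c y1 y2 Y + scalar_point a' b' A' B' c' y1' y2' Y' =
    scalar_point (a + a') (b + b') (A + A') (B + B') (c + c') (y1 + y1') (y2 + y2') (Y + Y')"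
  by (simp add: scalar_point_def vec_eq_iff forall_2)

lemma scalar_point_scaleR:
  "s *\<^sub>R scalar_point a b A B c y1 y2 Y =
    scalar_point (s * a) (s * b) (s * A) (s * B) (s * c) (s * y1) (s * y2) (s * Y)"
  by (simp add: scalar_point_def vec_eq_iff forall_2)

lemma scalar_point_in_H:
  assumes "y1 \<in> {0, 1}" "y2 \<in> {0, 1}" "0 \<le> a" "a \<le> y1" "0 \<le> b" "b \<le> y2"
  shows "scalar_point a b (a\<^sup>2) (b\<^sup>2) (a * b) y1 y2 (y1 * y2) \<in> H"
  unfolding H_def
proof (rule hull_inc, intro CollectI exI conjI)
  show "scalar_point a b (a\<^sup>2) (b\<^sup>2) (a * b) y1 y2 (y1 * y2) =
    (vector [a, b], outer (vector [a, b]), vector [y1, y2], (vector [y1, y2] :: real^2) $ 1 * (vector [y1, y2] :: real^2) $ 2)"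
    by (simp add: scalar_point_def outer_def vec_eq_iff forall_2 power2_eq_square)
qed (use assms in \<open>auto simp: less_eq_vec_def forall_2\<close>)

lemma convex_H: "convex H"
  by (simp add: H_def)

text \<open>Placing moments over \<open>y = (1, 1)\<close> is affine and sends the generators of
  \<open>moment_hull\<close> to generators of \<open>H\<close>.\<close>

lemma rlt_psd_scalar_point_in_H:
  assumes "rlt_psd 1 a b A B c"
  shows "scalar_point a b A B c 1 1 1 \<in> H"
proof -
  let ?T = "{(a, b, A, B, c). scalar_point a b A B c 1 1 1 \<in> H}"
  have "convex ?T"
  proof (rule convexI)
    fix x y s t assume xy: "x \<in> ?T" "y \<in> ?T" and st: "0 \<le> s" "0 \<le> t" "s + t = (1::real)"
    obtain a b A B c a' b' A' B' c' where [simp]: "x = (a, b, A, B, c)" "y = (a', b', A', B', c')"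
      by (metis prod_cases5)
    have "s *\<^sub>R scalar_point a b A B c 1 1 1 + t *\<^sub>R scalar_point a' b' A' B' c' 1 1 1 \<in> H"
      using xy st by (intro convexD[OF convex_H]) auto
    then show "s *\<^sub>R x + t *\<^sub>R y \<in> ?T" using st(3) by (simp add: scalar_point_add scalar_point_scaleR)
  qed
  then have "moment_hull \<subseteq> ?T"
    unfolding moment_hull_def using scalar_point_in_H[of 1 1] by (intro hull_minimal) auto
  moreover have "(a, b, A, B, c) \<in> rlt_psd_slice"
    using assms by (simp add: rlt_psd_slice_def)
  ultimately show ?thesis
    using rlt_psd_slice_subset_moment_hull by blast
qed

lemma rlt_psd_cone_in_H:
  assumes R: "rlt_psd l a b A B c"
  obtains h where "h \<in> H" "l *\<^sub>R h = scalar_point a b A B c l l l"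
proof (cases "l = 0")
  \<comment> \<open>The bounds force every entry to be 0, so any point of \<open>H\<close>
    serves.\<close>
  case True
  then have "a = 0" "b = 0" "A = 0" "B = 0" "c = 0"
    using rlt_psd_bounds[OF R] by auto
  then show ?thesis
    using that[OF scalar_point_in_H[of 0 0 0 0]] True by (simp add: scalar_point_scaleR)
next
  case False
  then have "0 < l" using rlt_psd_bounds[OF R] by simp
  then have "rlt_psd 1 (a / l) (b / l) (A / l) (B / l) (c / l)"
    using rlt_psd_combination[OF R R, of "1 / l" 0] by simp
  from that[OF rlt_psd_scalar_point_in_H[OF this]] show ?thesis
    using \<open>0 < l\<close> by (simp add: scalar_point_scaleR)
qed

lemma PER_atom:
  assumes "(a, b, c) \<in> PER"
  obtains w u where "0 \<le> w" "w \<le> c" "0 \<le> u" "u \<le> 1" "w * u = a" "w * u\<^sup>2 = b"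
proof (cases "b = 0")
  case True
  then show ?thesis using assms that[of 0 0] by (auto simp: PER_def)
next
  case False
  then have "0 < b" "0 < a" using assms by (auto simp: PER_def)
  then show ?thesis
    \<comment> \<open>The two moments determine the atom; its weight is at most \<open>c\<close>
      because \<open>a^2 \<le> b * c\<close>.\<close>
    using assms that[of "a\<^sup>2 / b" "b / a"] by (auto simp: PER_def power2_eq_square field_simps)
qed

lemma extended_set_projects_into_H:
  assumes E: "(x, X, y, Y, \<alpha>, \<beta>) \<in> extended_set"
  shows "(x, X, y, Y) \<in> H"
proof -
  note e = E[unfolded extended_set_iff]
  obtain h where h: "h \<in> H" "Y *\<^sub>R h = scalar_point (x $ 1 - \<alpha> $ 1) (x $ 2 - \<alpha> $ 2)
    (X $ 1 $ 1 - \<beta> $ 1) (X $ 2 $ 2 - \<beta> $ 2) (X $ 1 $ 2) Y Y Y"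
    using rlt_psd_cone_in_H e by blast
  obtain w1 u1 where 1: "0 \<le> w1" "w1 \<le> y $ 1 - Y" "0 \<le> u1" "u1 \<le> 1" "w1 * u1 = \<alpha> $ 1" "w1 * u1\<^sup>2 = \<beta> $ 1"
    using PER_atom e by blast
  obtain w2 u2 where 2: "0 \<le> w2" "w2 \<le> y $ 2 - Y" "0 \<le> u2" "u2 \<le> 1" "w2 * u2 = \<alpha> $ 2" "w2 * u2\<^sup>2 = \<beta> $ 2"
    using PER_atom e by blast
  \<comment> \<open>Mass \<open>Y\<close> sits over \<open>(1, 1)\<close>. Over
    \<open>(1, 0)\<close> and \<open>(0, 1)\<close> the \<open>PER\<close> atom is completed by an
    atom at \<open>x = 0\<close>. \<open>RLT_y\<close> makes the weight of \<open>(0, 0)\<close>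
    nonnegative.\<close>
  have "(\<Sum>(w, p)\<leftarrow>[(Y, h), (w1, scalar_point u1 0 (u1\<^sup>2) 0 0 1 0 0), (y $ 1 - Y - w1, scalar_point 0 0 0 0 0 1 0 0),
      (w2, scalar_point 0 u2 0 (u2\<^sup>2) 0 0 1 0), (y $ 2 - Y - w2, scalar_point 0 0 0 0 0 0 1 0),
      (1 - y $ 1 - y $ 2 + Y, scalar_point 0 0 0 0 0 0 0 0)]. w *\<^sub>R p) \<in> H"
    using h(1) e 1 2 scalar_point_in_H[of 1 0 u1 0] scalar_point_in_H[of 1 0 0 0]
      scalar_point_in_H[of 0 1 0 u2] scalar_point_in_H[of 0 1 0 0] scalar_point_in_H[of 0 0 0 0]
    by (intro convex_sum_list convex_H) auto
  then have "scalar_point (x $ 1) (x $ 2) (X $ 1 $ 1) (X $ 2 $ 2) (X $ 1 $ 2) (y $ 1) (y $ 2) Y \<in> H"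
    by (simp add: h(2) scalar_point_add scalar_point_scaleR 1(5,6) 2(5,6))
  moreover have "scalar_point (x $ 1) (x $ 2) (X $ 1 $ 1) (X $ 2 $ 2) (X $ 1 $ 2) (y $ 1) (y $ 2) Y = (x, X, y, Y)"
    using e by (simp add: scalar_point_def vec_eq_iff forall_2)
  ultimately show ?thesis by simp
qed

theorem theorem2:
  shows "H = (\<lambda>(x, X, y, Y12, \<alpha>, \<beta>). (x, X, y, Y12)) ` extended_set"
proof
  have "linear (\<lambda>(x, X, y, Y12, \<alpha>, \<beta>). (x, X, y, Y12) :: (real ^ 2) \<times> (real ^ 2 ^ 2) \<times> (real ^ 2) \<times> real)"
    by (rule linearI) auto
  then have "convex ((\<lambda>(x, X, y, Y12, \<alpha>, \<beta>). (x, X, y, Y12)) ` extended_set)"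
    by (rule convex_linear_image[OF _ convex_extended_set])
  moreover have "(x, outer x, y, y $ 1 * y $ 2) \<in> (\<lambda>(x, X, y, Y12, \<alpha>, \<beta>). (x, X, y, Y12)) ` extended_set"
    if "\<forall>j. y $ j \<in> {0, 1}" "0 \<le> x" "x \<le> y" for x y
    using generator_lifts[OF that] by (metis (no_types, lifting) case_prod_conv image_eqI)
  ultimately show "H \<subseteq> (\<lambda>(x, X, y, Y12, \<alpha>, \<beta>). (x, X, y, Y12)) ` extended_set"
    unfolding H_def by (intro hull_minimal) blast+
  show "(\<lambda>(x, X, y, Y12, \<alpha>, \<beta>). (x, X, y, Y12)) ` extended_set \<subseteq> H"
    using extended_set_projects_into_H by auto
qed

end
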